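(* Let $A,B_1,\ldots,B_m\in\mathcal{M}_D^{\mathrm{sym}}$, let $\gamma_i=1$ for all $i\in\{1,\ldots,m\}$, let $\epsilon>0$, and let $S$ be any real $d\times D$ matrix. Let $\eta\in\mathbb{R}$ satisfy $\eta\ge\operatorname{Tr}(X^* )$ for an optimal point $X^*$ of the sketchable SDP defined by these data. Let $\alpha$ be the value of the sketchable SDP, $\alpha_S$ the value of the sketched SDP, and $$\nu=3\epsilon\eta\max_{i\in\{1,\ldots,m\}}\|B_i\|_1 .$$ Then $$\frac{\alpha_S}{1+\nu}\ \le\ \alpha .$$ Moreover, if $X_S^*$ denotes an optimal point of the sketched SDP, then $\frac{1}{1+\nu}S^TX_S^*S$ is a feasible point of the sketchable SDP that attains this lower bound, i.e. $\operatorname{Tr}\big(A\,\tfrac{1}{1+\nu}S^TX_S^*S\big)=\frac{\alpha_S}{1+\nu}$.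
   Context: $\mathcal{M}_D^{\mathrm{sym}}$ is the set of real symmetric $D\times D$ matrices; $X\ge0$ means that the symmetric matrix $X$ is positive semidefinite; $\|B\|_1=\operatorname{Tr}[(B^TB)^{1/2}]$ is the Schatten $1$-norm. The sketchable SDP (with $\gamma_i=1$) is: maximize $\operatorname{Tr}(AX)$ subject to $\operatorname{Tr}(B_iX)\le1$ for $i=1,\ldots,m$, and $X\ge0$, over $X\in\mathcal{M}_D^{\mathrm{sym}}$. The sketched SDP is: maximize $\operatorname{Tr}(SAS^TY)$ subject to $\operatorname{Tr}(SB_iS^TY)\le1+3\epsilon\eta\|B_i\|_1$ for $i=1,\ldots,m$, and $Y\ge0$, over $Y\in\mathcal{M}_d^{\mathrm{sym}}$. The value of a maximization problem is the supremum of its objective over feasible points. *)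

theory Defs
  imports "HOL-Analysis.Analysis"
begin

definition symmetric_matrix :: "real^'n^'n \<Rightarrow> bool" where
  "symmetric_matrix X \<longleftrightarrow> transpose X = X"

definition psd :: "real^'n^'n \<Rightarrow> bool" where
  "psd X \<longleftrightarrow> symmetric_matrix X \<and> (\<forall>v. 0 \<le> v \<bullet> (X *v v))"

text \<open>The positive semidefinite square root; meaningful only for positive semidefinite \<open>M\<close>,
  where it exists and is unique.\<close>

definition psd_sqrt :: "real^'n^'n \<Rightarrow> real^'n^'n" where
  "psd_sqrt M = (THE R. psd R \<and> R ** R = M)"

definition schatten1_norm :: "real^'n^'n \<Rightarrow> real" where
  "schatten1_norm B = trace (psd_sqrt (transpose B ** B))"

text \<open>The SDP of maximizing \<open>Tr(A X)\<close> subject to \<open>Tr(B\<^sub>i X) \<le> \<gamma>\<^sub>i\<close> for \<open>i = 1, \<dots>, m\<close> and \<open>X \<ge> 0\<close>.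
  Values of \<open>B\<close> and \<open>\<gamma>\<close> outside \<open>{1..m}\<close> play no role.\<close>

definition sdp_feasible ::
  "nat \<Rightarrow> (nat \<Rightarrow> real^'n^'n) \<Rightarrow> (nat \<Rightarrow> real) \<Rightarrow> (real^'n^'n) set" where
  "sdp_feasible m B \<gamma> = {X. psd X \<and> (\<forall>i\<in>{1..m}. trace (B i ** X) \<le> \<gamma> i)}"

text \<open>The value is an extended real, so that an unbounded problem has value \<open>\<infinity>\<close>.\<close>

definition sdp_value ::
  "nat \<Rightarrow> real^'n^'n \<Rightarrow> (nat \<Rightarrow> real^'n^'n) \<Rightarrow> (nat \<Rightarrow> real) \<Rightarrow> ereal" where
  "sdp_value m A B \<gamma> = (SUP X\<in>sdp_feasible m B \<gamma>. ereal (trace (A ** X)))"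

definition sdp_optimal ::
  "nat \<Rightarrow> real^'n^'n \<Rightarrow> (nat \<Rightarrow> real^'n^'n) \<Rightarrow> (nat \<Rightarrow> real) \<Rightarrow> real^'n^'n \<Rightarrow> bool" where
  "sdp_optimal m A B \<gamma> X \<longleftrightarrow>
     X \<in> sdp_feasible m B \<gamma> \<and> (\<forall>Z\<in>sdp_feasible m B \<gamma>. trace (A ** Z) \<le> trace (A ** X))"

definition sketch :: "real^'D^'d \<Rightarrow> real^'D^'D \<Rightarrow> real^'d^'d" where
  "sketch S M = S ** M ** transpose S"

text \<open>Right-hand sides of the relaxed constraints of the sketched SDP for \<open>\<gamma>\<^sub>i = 1\<close>.\<close>

definition sketched_bound :: "real \<Rightarrow> real \<Rightarrow> (nat \<Rightarrow> real^'D^'D) \<Rightarrow> nat \<Rightarrow> real" where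
  "sketched_bound \<epsilon> \<eta> B i = 1 + 3 * \<epsilon> * \<eta> * schatten1_norm (B i)"

end

theory Submission
  imports Defs
begin

text \<open>The point is that \<open>Tr(S M S\<^sup>T Y) = Tr(M S\<^sup>T Y S)\<close>: the map \<open>Y \<mapsto> S\<^sup>T Y S / (1 + \<nu>)\<close>
  carries feasible points of the sketched problem to feasible points of the original one and
  scales the objective by \<open>1 / (1 + \<nu>)\<close>. This uses \<open>0 \<le> \<eta>\<close>, which holds because \<open>\<eta>\<close> bounds the
  trace of a positive semidefinite matrix, and \<open>0 \<le> \<parallel>B\<^sub>i\<parallel>\<^sub>1\<close>, which amounts to the existence and
  uniqueness of the positive square root of \<open>B\<^sub>i\<^sup>2\<close>.\<close>

section \<open>Spectral theorem for self-adjoint maps\<close>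

text \<open>Moving from \<open>v\<close> a small distance \<open>t\<close> along
  \<open>- g v\<close> changes the quadratic form by a negative term linear in \<open>t\<close> plus
  a term quadratic in \<open>t\<close>, so the form would drop below zero unless
  \<open>g v = 0\<close>.\<close>

lemma positive_form_eq_0_imp_kernel:
  fixes g :: "'a::real_inner \<Rightarrow> 'a"
  assumes "linear g" "\<And>x y. g x \<bullet> y = x \<bullet> g y" "subspace V"
    and pos: "\<And>w. w \<in> V \<Longrightarrow> 0 \<le> w \<bullet> g w"
    and "v \<in> V" "g v \<in> V" "v \<bullet> g v = 0"
  shows "g v = 0"
proof -
  define u where "u = g v"
  define c where "c = u \<bullet> g u"
  \<comment> \<open>The form at \<open>v - t *\<^sub>R u\<close> is
    \<open>t * (t * c - 2 * (u \<bullet> u))\<close>. This choice gives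
    \<open>t * c \<le> u \<bullet> u\<close>, and the denominator \<open>c + 1\<close> also covers
    \<open>c = 0\<close>.\<close>
  define t where "t = (u \<bullet> u) / (c + 1)"
  have "0 \<le> c"
    unfolding c_def u_def using pos assms by blast
  have "v - t *\<^sub>R u \<in> V"
    using assms by (simp add: u_def subspace_diff subspace_scale)
  then have "0 \<le> (v - t *\<^sub>R u) \<bullet> g (v - t *\<^sub>R u)"
    by (rule pos)
  also have "\<dots> = t * (t * c - 2 * (u \<bullet> u))"
  proof -
    have "v \<bullet> g u = u \<bullet> u"
      using assms(2)[of v u] by (simp add: u_def)
    moreover have g: "g (v - t *\<^sub>R u) = u - t *\<^sub>R g u"
      using \<open>linear g\<close> by (simp add: linear_diff linear_scale u_def)
    moreover have "v \<bullet> u = 0"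
      using assms(7) by (simp add: u_def)
    ultimately show ?thesis
      unfolding g by (simp add: inner_diff_left inner_diff_right c_def algebra_simps)
  qed
  finally have *: "0 \<le> t * (t * c - 2 * (u \<bullet> u))" .
  show ?thesis
  proof (rule ccontr)
    assume "g v \<noteq> 0"
    then have u: "0 < u \<bullet> u" by (simp add: u_def)
    then have "0 < t" using \<open>0 \<le> c\<close> by (simp add: t_def)
    then have "2 * (u \<bullet> u) \<le> t * c" using * by (simp add: zero_le_mult_iff)
    moreover have "t * c = (u \<bullet> u) * (c / (c + 1))" by (simp add: t_def)
    moreover have "(u \<bullet> u) * (c / (c + 1)) \<le> (u \<bullet> u) * 1"
      using \<open>0 \<le> c\<close> by (intro mult_left_mono) (auto simp: divide_simps)
    ultimately show False using u by linarith
  qed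
qed

text \<open>The form of \<open>f\<close> attains its maximum \<open>l\<close> on the unit sphere of
  \<open>V\<close> by compactness. By homogeneity the form of \<open>l - f\<close> is then
  nonnegative on \<open>V\<close>, and it vanishes at the maximizer, which therefore lies in the
  kernel of \<open>l - f\<close>.\<close>

lemma selfadjoint_eigenvector:
  fixes f :: "'a::euclidean_space \<Rightarrow> 'a"
  assumes "linear f" and adj: "\<And>x y. f x \<bullet> y = x \<bullet> f y" and "subspace V"
    and inv: "\<And>x. x \<in> V \<Longrightarrow> f x \<in> V" and "x \<in> V" "x \<noteq> 0"
  obtains v l where "v \<in> V" "norm v = 1" "f v = l *\<^sub>R v"
proof -
  let ?K = "sphere 0 1 \<inter> V"
  have "compact ?K"
    using \<open>subspace V\<close> by (intro compact_Int_closed closed_subspace) auto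
  moreover have "x /\<^sub>R norm x \<in> ?K"
    using assms by (simp add: subspace_scale)
  moreover have "continuous_on ?K (\<lambda>v. v \<bullet> f v)"
    using \<open>linear f\<close> by (intro continuous_intros linear_continuous_on linear_conv_bounded_linear[THEN iffD1])
  ultimately obtain v where v: "v \<in> ?K" and max: "\<And>w. w \<in> ?K \<Longrightarrow> w \<bullet> f w \<le> v \<bullet> f v"
    using continuous_attains_sup[of ?K "\<lambda>v. v \<bullet> f v"] by blast
  define l where "l = v \<bullet> f v"
  define g where "g = (\<lambda>w. l *\<^sub>R w - f w)"
  have pos: "0 \<le> w \<bullet> g w" if "w \<in> V" for w
  proof (cases "w = 0")
    case False
    let ?u = "w /\<^sub>R norm w"
    have "?u \<in> ?K" using that False \<open>subspace V\<close> by (simp add: subspace_scale)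
    then have "?u \<bullet> f ?u \<le> l" unfolding l_def by (rule max)
    also have "?u \<bullet> f ?u = (w \<bullet> f w) / (norm w)\<^sup>2"
      using \<open>linear f\<close> by (simp add: linear_scale power2_eq_square divide_simps)
    finally show ?thesis
      using False by (simp add: g_def inner_diff_right divide_simps power2_norm_eq_inner mult.commute)
  qed (simp add: g_def)
  have "g v = 0"
  proof (rule positive_form_eq_0_imp_kernel[of g V])
    show "linear g"
      unfolding g_def using \<open>linear f\<close> by (intro linear_compose_sub linear_scale_self)
    show "g x \<bullet> y = x \<bullet> g y" for x y
      by (simp add: g_def inner_diff_left inner_diff_right adj)
    show "g v \<in> V"
      using v inv \<open>subspace V\<close> by (simp add: g_def subspace_diff subspace_scale)
    show "v \<bullet> g v = 0"
      using v by (simp add: g_def inner_diff_right l_def flip: power2_norm_eq_inner)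
  qed (use v pos \<open>subspace V\<close> in auto)
  then have "f v = l *\<^sub>R v" by (simp add: g_def)
  with v show ?thesis by (intro that) auto
qed

text \<open>An orthonormal family of eigenvectors of maximal size must span: otherwise its
  orthogonal complement, which \<open>f\<close> leaves invariant, would contain a further
  eigenvector.\<close>

lemma selfadjoint_eigenbasis:
  fixes f :: "'a::euclidean_space \<Rightarrow> 'a"
  assumes "linear f" and adj: "\<And>x y. f x \<bullet> y = x \<bullet> f y"
  obtains E l where "finite E" "pairwise orthogonal E" "\<And>v. v \<in> E \<Longrightarrow> norm v = 1"
    "\<And>v. v \<in> E \<Longrightarrow> f v = l v *\<^sub>R v" "\<And>x. x = (\<Sum>v\<in>E. (v \<bullet> x) *\<^sub>R v)"
proof -
  define P where "P E \<longleftrightarrow> finite E \<and> pairwise orthogonal E \<and> (\<forall>v\<in>E. norm v = 1 \<and> (\<exists>l. f v = l *\<^sub>R v))" for E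
  have bound: "card E \<le> DIM('a)" if "P E" for E
  proof -
    have "0 \<notin> E" using that by (auto simp: P_def)
    with that have "independent E" unfolding P_def by (intro pairwise_orthogonal_independent) blast+
    then show ?thesis by (rule independent_bound_general[THEN conjunct2, THEN order_trans]) (rule dim_subset_UNIV)
  qed
  have "P {}" by (simp add: P_def)
  then obtain E where E: "P E" and max: "\<And>F. P F \<Longrightarrow> card F \<le> card E"
    using ex_has_greatest_nat[of P "{}" card "Suc (DIM('a))"] bound by (metis le_imp_less_Suc)
  then obtain l where l: "\<And>v. v \<in> E \<Longrightarrow> f v = l v *\<^sub>R v"
    unfolding P_def by metis
  define V where "V = {x. \<forall>v\<in>E. v \<bullet> x = 0}"
  have V: "subspace V" by (auto simp: V_def subspace_def inner_add_right)
  have "x = (\<Sum>v\<in>E. (v \<bullet> x) *\<^sub>R v)" for x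
  proof (rule ccontr)
    let ?y = "x - (\<Sum>v\<in>E. (v \<bullet> x) *\<^sub>R v)"
    assume "x \<noteq> (\<Sum>v\<in>E. (v \<bullet> x) *\<^sub>R v)"
    then have "?y \<noteq> 0" by simp
    moreover have "?y \<in> V"
    proof -
      have "w \<bullet> (\<Sum>v\<in>E. (v \<bullet> x) *\<^sub>R v) = w \<bullet> x" if "w \<in> E" for w
      proof -
        have "w \<bullet> (\<Sum>v\<in>E. (v \<bullet> x) *\<^sub>R v) = (\<Sum>v\<in>E. (v \<bullet> x) * (w \<bullet> v))"
          by (simp add: inner_sum_right)
        also have "\<dots> = (\<Sum>v\<in>E. if v = w then w \<bullet> x else 0)"
          using that E by (intro sum.cong refl)
            (auto simp: P_def pairwise_def orthogonal_def norm_eq_1)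
        finally show ?thesis using that E by (simp add: P_def)
      qed
      then show ?thesis by (simp add: V_def inner_diff_right)
    qed
    \<comment> \<open>Self-adjointness moves \<open>f\<close> onto the eigenvector: \<open>v
      \<bullet> f z = f v \<bullet> z = l v * (v \<bullet> z) = 0\<close>.\<close>
    moreover have "f z \<in> V" if "z \<in> V" for z
      using that l by (simp add: V_def flip: adj)
    ultimately obtain u k where u: "u \<in> V" "norm u = 1" "f u = k *\<^sub>R u"
      using selfadjoint_eigenvector[OF assms V] by metis
    have "u \<notin> E" using u by (auto simp: V_def norm_eq_1)
    moreover have "P (insert u E)"
      using E u by (auto simp: P_def pairwise_insert V_def orthogonal_def inner_commute)
    ultimately show False using max[of "insert u E"] E by (simp add: P_def)
  qed
  with E l that show ?thesis unfolding P_def by blast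
qed

section \<open>Symmetric and positive semidefinite matrices\<close>

lemma symmetric_matrix_inner:
  "symmetric_matrix M \<Longrightarrow> (M *v x) \<bullet> y = x \<bullet> (M *v y)"
  by (metis symmetric_matrix_def dot_lmul_matrix transpose_matrix_vector inner_commute)

lemma symmetric_matrixI:
  fixes M :: "real^'n^'n"
  assumes "\<And>x y. (M *v x) \<bullet> y = x \<bullet> (M *v y)"
  shows "symmetric_matrix M"
proof -
  have "M $ i $ j = M $ j $ i" for i j
    using assms[of "axis i 1" "axis j 1"]
    by (simp add: matrix_vector_mult_basis column_def inner_axis' inner_axis)
  then show ?thesis
    by (simp add: symmetric_matrix_def transpose_def vec_eq_iff)
qed

lemma psd_kernel:
  fixes M :: "real^'n^'n"
  assumes "psd M" "v \<bullet> (M *v v) = 0"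
  shows "M *v v = 0"
  using assms positive_form_eq_0_imp_kernel[of "(*v) M" UNIV v]
  by (simp add: psd_def symmetric_matrix_inner)

lemma trace_eq_sum_forms:
  "trace M = (\<Sum>i\<in>UNIV. axis i 1 \<bullet> (M *v axis i 1))" for M :: "real^'n^'n"
  by (simp add: trace_def matrix_vector_mult_basis column_def inner_axis')

lemma trace_psd_nonneg: "psd M \<Longrightarrow> 0 \<le> trace M"
  unfolding trace_eq_sum_forms by (intro sum_nonneg) (simp add: psd_def)

section \<open>The positive square root and the Schatten norm\<close>

text \<open>The root is the absolute value of \<open>M\<close>: it keeps the eigenvectors of
  \<open>M\<close> and replaces each eigenvalue by its absolute value, which has the same
  square.\<close>

lemma symmetric_square_has_psd_sqrt:
  fixes M :: "real^'n^'n"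
  assumes "symmetric_matrix M"
  obtains R where "psd R" "R ** R = M ** M"
proof -
  obtain E l where E: "finite E" "pairwise orthogonal E" "\<And>v. v \<in> E \<Longrightarrow> norm v = 1"
    and l: "\<And>v. v \<in> E \<Longrightarrow> M *v v = l v *\<^sub>R v" and ex: "\<And>x. x = (\<Sum>v\<in>E. (v \<bullet> x) *\<^sub>R v)"
    using selfadjoint_eigenbasis[of "(*v) M"] assms by (auto simp: symmetric_matrix_inner)
  define r where "r x = (\<Sum>v\<in>E. (\<bar>l v\<bar> * (v \<bullet> x)) *\<^sub>R v)" for x
  have r: "linear r"
    by (rule linearI) (simp_all add: r_def inner_add_right algebra_simps sum.distrib scaleR_sum_right)
  then have R: "matrix r *v x = r x" for x by simp
  have E_r: "r v = \<bar>l v\<bar> *\<^sub>R v" if "v \<in> E" for v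
  proof -
    have "r v = (\<Sum>w\<in>E. if w = v then \<bar>l v\<bar> *\<^sub>R v else 0)"
      unfolding r_def using that E
      by (intro sum.cong refl) (auto simp: pairwise_def orthogonal_def norm_eq_1)
    with that E show ?thesis by simp
  qed
  \<comment> \<open>Both sides are linear in \<open>x\<close> and agree on the eigenvectors in
    \<open>E\<close>, so the expansion in \<open>E\<close> settles all \<open>x\<close>.\<close>
  have "r (r x) = M *v (M *v x)" for x
  proof -
    have "r (r x) = (\<Sum>v\<in>E. (v \<bullet> x) *\<^sub>R r (r v))"
      by (subst ex[of x]) (simp add: linear_sum[OF r] linear_scale[OF r])
    also have "\<dots> = (\<Sum>v\<in>E. (v \<bullet> x) *\<^sub>R (M *v (M *v v)))"
      by (intro sum.cong refl) (simp add: E_r l linear_scale[OF r] matrix_vector_mult_scaleR)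
    also have "\<dots> = M *v (M *v x)"
      by (subst arg_cong[OF ex, of "\<lambda>x. M *v (M *v x)" x])
        (simp add: linear_sum matrix_vector_mult_scaleR)
    finally show ?thesis .
  qed
  then have "matrix r ** matrix r = M ** M"
    by (simp add: matrix_eq R flip: matrix_vector_mul_assoc)
  moreover have "psd (matrix r)"
  proof -
    have "symmetric_matrix (matrix r)"
      by (rule symmetric_matrixI)
        (simp add: R r_def inner_sum_left inner_sum_right inner_commute mult_ac)
    moreover have "0 \<le> x \<bullet> r x" for x
      by (auto simp: r_def inner_sum_right inner_commute mult.assoc intro!: sum_nonneg)
    ultimately show ?thesis by (simp add: psd_def R)
  qed
  ultimately show ?thesis using that by blast
qed

text \<open>With \<open>D = R - T\<close> one has \<open>R D + D T = 0\<close>, so the positive semidefinite matrices \<open>D R D\<close> and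
  \<open>D T D\<close> have traces adding up to zero; hence both \<open>R D\<close> and \<open>T D\<close> vanish, and with them
  \<open>D\<^sup>2\<close>.\<close>

lemma psd_sqrt_unique:
  fixes R T :: "real^'n^'n"
  assumes "psd R" "psd T" "R ** R = T ** T"
  shows "R = T"
proof -
  define D where "D = R - T"
  have sym: "symmetric_matrix R" "symmetric_matrix T" and
    pos: "0 \<le> v \<bullet> (R *v v)" "0 \<le> v \<bullet> (T *v v)" for v
    using assms by (auto simp: psd_def)
  have D: "D *v v = R *v v - T *v v" for v
    by (simp add: D_def matrix_vector_mult_diff_rdistrib)
  have Dadj: "(D *v x) \<bullet> y = x \<bullet> (D *v y)" for x y
    using sym by (simp add: D inner_diff_left inner_diff_right symmetric_matrix_inner)
  \<comment> \<open>As \<open>D\<close> is self-adjoint, \<open>?q M i\<close> is the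
    \<open>i\<close>-th diagonal entry of \<open>D ** M ** D\<close>.\<close>
  let ?q = "\<lambda>M i. (D *v axis i 1) \<bullet> (M *v (D *v axis i 1))"
  have "R *v (R *v v) = T *v (T *v v)" for v
    using assms(3) by (simp add: matrix_vector_mul_assoc)
  \<comment> \<open>The mixed products \<open>R ** T\<close> cancel, which leaves
    \<open>R ** R - T ** T\<close>.\<close>
  then have "R ** D + D ** T = 0"
    by (simp add: matrix_eq D matrix_vector_mult_add_rdistrib matrix_vector_mult_diff_distrib
        flip: matrix_vector_mul_assoc)
  then have "0 = trace (D ** (R ** D + D ** T))"
    by (simp add: trace_def)
  also have "\<dots> = trace (D ** R ** D) + trace (D ** (D ** T))"
    by (simp add: matrix_add_ldistrib trace_add matrix_mul_assoc)
  also have "trace (D ** (D ** T)) = trace (D ** T ** D)"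
    by (rule trace_mul_sym)
  finally have "trace (D ** R ** D) + trace (D ** T ** D) = 0" by simp
  then have "(\<Sum>i\<in>UNIV. ?q R i + ?q T i) = 0"
    by (simp add: trace_eq_sum_forms sum.distrib Dadj flip: matrix_vector_mul_assoc)
  then have "?q R i + ?q T i = 0" for i
    using pos by (subst (asm) sum_nonneg_eq_0_iff) (auto intro: add_nonneg_nonneg)
  then have q: "?q R i = 0" "?q T i = 0" for i
    using pos by (simp_all add: add_nonneg_eq_0_iff)
  have "D *v axis i 1 = 0" for i
  proof -
    have "D *v (D *v axis i 1) = 0"
      using psd_kernel[OF assms(1) q(1)] psd_kernel[OF assms(2) q(2)] by (simp add: D)
    \<comment> \<open>Self-adjointness turns the vanishing of \<open>D\<close> squared on a basis
      vector into that of the squared norm of its image under \<open>D\<close>.\<close>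
    then show ?thesis using Dadj[of "axis i 1" "D *v axis i 1"] by simp
  qed
  then have "D = 0"
    by (simp add: matrix_vector_mult_basis column_def vec_eq_iff)
  then show ?thesis by (simp add: D_def)
qed

text \<open>Since \<open>psd_sqrt\<close> is a definite description, existence and uniqueness
  together make its value positive semidefinite, and its trace is then nonnegative.\<close>

lemma schatten1_norm_nonneg:
  assumes "symmetric_matrix M"
  shows "0 \<le> schatten1_norm M"
proof -
  obtain R where "psd R" "R ** R = M ** M"
    using assms by (rule symmetric_square_has_psd_sqrt)
  then have "psd (psd_sqrt (M ** M))"
    unfolding psd_sqrt_def by (rule_tac theI2[of _ R]) (auto intro: psd_sqrt_unique)
  with assms show ?thesis
    by (simp add: schatten1_norm_def symmetric_matrix_def trace_psd_nonneg)
qed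

section \<open>Lifting sketched solutions to the original problem\<close>

lemma trace_sketch: "trace (sketch S M ** Y) = trace (M ** (transpose S ** Y ** S))"
  unfolding sketch_def by (metis matrix_mul_assoc trace_mul_sym)

lemma trace_mult_scaleR:
  fixes M X :: "real^'n^'n"
  shows "trace (M ** (c *\<^sub>R X)) = c * trace (M ** X)"
  by (simp add: trace_def matrix_matrix_mult_def sum_distrib_left mult_ac)

lemma psd_scaleR: "0 \<le> c \<Longrightarrow> psd X \<Longrightarrow> psd (c *\<^sub>R X)"
  by (simp add: psd_def symmetric_matrix_def transpose_scalar scaleR_matrix_vector_assoc[symmetric])

lemma psd_congruence:
  fixes S :: "real^'n^'m"
  assumes "psd Y"
  shows "psd (transpose S ** Y ** S)"
proof -
  have "v \<bullet> (transpose S ** Y ** S *v v) = (S *v v) \<bullet> (Y *v (S *v v))" for v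
    by (metis dot_lmul_matrix inner_commute matrix_vector_mul_assoc transpose_matrix_vector)
  with assms show ?thesis
    by (simp add: psd_def symmetric_matrix_def matrix_transpose_mul matrix_mul_assoc)
qed

theorem theorem5p7:
  fixes A :: "real^'D^'D" and B :: "nat \<Rightarrow> real^'D^'D" and S :: "real^'D^'d"
    and m :: nat and \<epsilon> \<eta> \<nu> :: real and \<alpha> \<alpha>\<^sub>S :: ereal and Xopt :: "real^'D^'D"
  assumes "m \<ge> 1"
    and "symmetric_matrix A"
    and "\<And>i. i \<in> {1..m} \<Longrightarrow> symmetric_matrix (B i)"
    and "\<epsilon> > 0"
    and "sdp_optimal m A B (\<lambda>_. 1) Xopt"
    and "\<eta> \<ge> trace Xopt"
    and "\<alpha> = sdp_value m A B (\<lambda>_. 1)"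
    and "\<alpha>\<^sub>S = sdp_value m (sketch S A) (\<lambda>i. sketch S (B i)) (sketched_bound \<epsilon> \<eta> B)"
    and "\<nu> = 3 * \<epsilon> * \<eta> * Max ((\<lambda>i. schatten1_norm (B i)) ` {1..m})"
  shows "\<alpha>\<^sub>S / ereal (1 + \<nu>) \<le> \<alpha>
    \<and> (\<forall>X\<^sub>S. sdp_optimal m (sketch S A) (\<lambda>i. sketch S (B i)) (sketched_bound \<epsilon> \<eta> B) X\<^sub>S \<longrightarrow>
         (1 / (1 + \<nu>)) *\<^sub>R (transpose S ** X\<^sub>S ** S) \<in> sdp_feasible m B (\<lambda>_. 1)
         \<and> ereal (trace (A ** ((1 / (1 + \<nu>)) *\<^sub>R (transpose S ** X\<^sub>S ** S)))) = \<alpha>\<^sub>S / ereal (1 + \<nu>))"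
proof -
  let ?FS = "sdp_feasible m (\<lambda>i. sketch S (B i)) (sketched_bound \<epsilon> \<eta> B)"
  let ?lift = "\<lambda>Y. (1 / (1 + \<nu>)) *\<^sub>R (transpose S ** Y ** S)"
  let ?max = "Max ((\<lambda>i. schatten1_norm (B i)) ` {1..m})"
  have "0 \<le> trace Xopt"
    using assms(5) by (simp add: sdp_optimal_def sdp_feasible_def trace_psd_nonneg)
  with assms have \<eta>: "0 \<le> \<eta>" by simp
  have max: "schatten1_norm (B i) \<le> ?max" if "i \<in> {1..m}" for i
    using that by (intro Max_ge) auto
  \<comment> \<open>The index 1 is available because \<open>m \<ge> 1\<close>; one nonnegative norm
    below the maximum makes the maximum nonnegative.\<close>
  moreover have "0 \<le> schatten1_norm (B 1)"
    using assms by (intro schatten1_norm_nonneg) simp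
  ultimately have "0 \<le> ?max" using \<open>m \<ge> 1\<close> by (meson atLeastAtMost_iff order.refl order_trans)
  then have \<nu>: "0 \<le> \<nu>" using \<eta> \<open>\<epsilon> > 0\<close> by (simp add: assms(9))
  \<comment> \<open>A single factor \<open>1 + \<nu>\<close> dominates all relaxed right-hand sides,
    so one rescaling restores every constraint at once.\<close>
  have bound: "sketched_bound \<epsilon> \<eta> B i \<le> 1 + \<nu>" if "i \<in> {1..m}" for i
    unfolding sketched_bound_def assms(9) using max[OF that] \<eta> \<open>\<epsilon> > 0\<close>
    by (intro add_left_mono mult_left_mono) auto
  have objective: "trace (A ** ?lift Y) = trace (sketch S A ** Y) / (1 + \<nu>)" for Y
    by (simp add: trace_mult_scaleR trace_sketch)
  have feasible: "?lift Y \<in> sdp_feasible m B (\<lambda>_. 1)" if "Y \<in> ?FS" for Y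
  proof -
    have "trace (B i ** ?lift Y) \<le> 1" if i: "i \<in> {1..m}" for i
    proof -
      have "trace (sketch S (B i) ** Y) \<le> 1 + \<nu>"
        using \<open>Y \<in> ?FS\<close> i bound[OF i] by (force simp: sdp_feasible_def)
      then show ?thesis using \<nu> by (simp add: trace_mult_scaleR trace_sketch)
    qed
    moreover have "psd (?lift Y)"
      using that \<nu> by (intro psd_scaleR psd_congruence) (auto simp: sdp_feasible_def)
    ultimately show ?thesis by (simp add: sdp_feasible_def)
  qed
  \<comment> \<open>In this multiplied form the bound on the supremum can be checked at each
    feasible \<open>Y\<close>; dividing afterwards by a positive real is sound for infinite values
    too.\<close>
  have "\<alpha>\<^sub>S \<le> ereal (1 + \<nu>) * \<alpha>"
    unfolding assms(8) sdp_value_def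
  proof (rule SUP_least)
    fix Y assume "Y \<in> ?FS"
    then have "ereal (trace (A ** ?lift Y)) \<le> \<alpha>"
      unfolding assms(7) sdp_value_def by (intro SUP_upper feasible)
    then have "ereal (1 + \<nu>) * ereal (trace (A ** ?lift Y)) \<le> ereal (1 + \<nu>) * \<alpha>"
      using \<nu> by (intro ereal_mult_left_mono) auto
    then show "ereal (trace (sketch S A ** Y)) \<le> ereal (1 + \<nu>) * \<alpha>"
      using \<nu> by (simp add: objective)
  qed
  then have "\<alpha>\<^sub>S / ereal (1 + \<nu>) \<le> \<alpha>"
    using \<nu> by (subst ereal_divide_le_pos) (auto simp: mult.commute)
  moreover have "ereal (trace (A ** ?lift X\<^sub>S)) = \<alpha>\<^sub>S / ereal (1 + \<nu>)"
    if "sdp_optimal m (sketch S A) (\<lambda>i. sketch S (B i)) (sketched_bound \<epsilon> \<eta> B) X\<^sub>S" for X\<^sub>S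
  proof -
    \<comment> \<open>An optimal point attains the supremum, so here the value is a real number and
      the division is the ordinary one.\<close>
    have "\<alpha>\<^sub>S = ereal (trace (sketch S A ** X\<^sub>S))"
      unfolding assms(8) sdp_value_def using that
      by (intro antisym SUP_least SUP_upper) (auto simp: sdp_optimal_def)
    then show ?thesis using \<nu> by (simp add: objective)
  qed
  ultimately show ?thesis
    using feasible unfolding sdp_optimal_def by blast
qed

end
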